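(* Let $\mathcal H$ be a complex Hilbert space with complex conjugation, $\eta\in\{-1,+1\}$, and let $S,\Sigma$ be commuting symmetry operators on $\mathcal H$ with $S^2=\eta\mathbf 1$ and $\Sigma^2=\eta\mathbf 1$. Let $P$ and $Q$ be orthogonal projections with $S^*\overline PS=\mathbf 1-P$, $S^*\overline QS=\mathbf 1-Q$, $[\Sigma,P]=[\Sigma,Q]=0$, and let $F$ be a unitary with $\Sigma^*\overline F\Sigma=F$ and $[S,F]=0$, such that $T=PFP+\mathbf 1-P$ is Fredholm. Let $\Phi$ and $\Psi$ be Lagrangian frames with respect to $S$ for $P$ and $Q$ respectively, i.e. $P=\Phi\Phi^*$, $Q=\Psi\Psi^*$, and set $T_0=\Psi^*F\Phi$. Then, for an eigenvector $v\neq0$, $$T_0^*T_0\,v=\lambda v,\qquad\lambda>0,$$ implies that $$w=\overline{(S\overline\Phi)^*\Sigma\,F^*\Psi\Psi^*F\Phi\,v}$$ is linearly independent of $v$ and also satisfies $T_0^*T_0\,w=\lambda w$. Upon iteration one deduces that each non-vanishing eigenvalue of $T_0^*T_0$ has even degeneracy.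
   Context: A complex conjugation $\mathcal C$ is an anti-linear isometric map with $\mathcal C^2=\mathbf 1$. For operators (also between two Hilbert spaces with complex conjugations) $\overline A=\mathcal CA\mathcal C$ and $A^t=(\overline A)^*$; for vectors $\overline v=\mathcal Cv$. A symmetry operator is a real unitary ($\overline S=S$) squaring to $\mathbf 1$ or $-\mathbf 1$ with eigenspaces of the same dimension (the identity is also admitted). A Lagrangian frame with respect to $S$ is a linear map $\Phi:\mathcal H_0\to\mathcal H$ from an auxiliary Hilbert space $\mathcal H_0$ with complex conjugation satisfying $\Phi^*\Phi=\mathbf 1_{\mathcal H_0}$ and $\Phi\Phi^*+(S\overline\Phi)(S\overline\Phi)^*=\mathbf 1_{\mathcal H}$.
   Formalization: The eigenvalue λ=1 is excluded from the linear independence and even degeneracy claims (there w=0 and both can fail, e.g. H=C², S=Σ a rotation by 90°, F=1); T_0^*T_0 w=λw is kept for all λ>0, and infinite degeneracy counts as even. *)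

theory Defs
  imports "HOL-Analysis.Analysis" "HOL-Library.Equipollence"
begin

section \<open>Complex Hilbert spaces\<close>

class scaleC =
  fixes scaleC :: "complex \<Rightarrow> 'a \<Rightarrow> 'a" (infixr "*\<^sub>C" 75)

class complex_vector = real_vector + scaleC +
  assumes scaleC_add_right: "a *\<^sub>C (x + y) = a *\<^sub>C x + a *\<^sub>C y"
    and scaleC_add_left: "(a + b) *\<^sub>C x = a *\<^sub>C x + b *\<^sub>C x"
    and scaleC_scaleC: "a *\<^sub>C b *\<^sub>C x = (a * b) *\<^sub>C x"
    and scaleC_one: "1 *\<^sub>C x = x"
    and scaleR_scaleC: "r *\<^sub>R x = complex_of_real r *\<^sub>C x"

global_interpretation complex_vector: vector_space "scaleC :: complex \<Rightarrow> 'a \<Rightarrow> 'a::complex_vector"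
  by unfold_locales (simp_all add: scaleC_add_right scaleC_add_left scaleC_scaleC scaleC_one)

text \<open>The inner product is conjugate-linear in its first argument. Positive definiteness
  follows from the last axiom and the norm axioms.\<close>

class complex_inner = complex_vector + real_normed_vector +
  fixes cinner :: "'a \<Rightarrow> 'a \<Rightarrow> complex"
  assumes cinner_commute: "cinner x y = cnj (cinner y x)"
    and cinner_add_left: "cinner (x + y) z = cinner x z + cinner y z"
    and cinner_scaleC_left: "cinner (c *\<^sub>C x) y = cnj c * cinner x y"
    and cinner_self: "cinner x x = complex_of_real ((norm x)\<^sup>2)"

class chilbert_space = complex_inner + complete_space

definition finite_cdim :: "'a::complex_vector set \<Rightarrow> bool" where
  "finite_cdim E \<longleftrightarrow> (\<exists>B. finite B \<and> E \<subseteq> complex_vector.span B)"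

definition orthonormal_basis_of :: "'a::complex_inner set \<Rightarrow> 'a set \<Rightarrow> bool" where
  "orthonormal_basis_of B E \<longleftrightarrow>
     (\<forall>x\<in>B. \<forall>y\<in>B. cinner x y = (if x = y then 1 else 0)) \<and>
     closure (complex_vector.span B) = E"

text \<open>Equality of Hilbert space dimensions (possibly infinite), for closed subspaces.\<close>

definition same_hilbert_dim :: "'a::complex_inner set \<Rightarrow> 'a set \<Rightarrow> bool" where
  "same_hilbert_dim E E' \<longleftrightarrow>
     (\<exists>B B'. orthonormal_basis_of B E \<and> orthonormal_basis_of B' E' \<and> B \<approx> B')"

section \<open>Operators\<close>

definition bounded_clinear :: "('a::complex_inner \<Rightarrow> 'b::complex_inner) \<Rightarrow> bool" where
  "bounded_clinear A \<longleftrightarrow> bounded_linear A \<and> (\<forall>c x. A (c *\<^sub>C x) = c *\<^sub>C A x)"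

text \<open>As for the real \<^const>\<open>adjoint\<close> of the library, the choice is only meaningful when an
  adjoint exists, e.g. for bounded operators between Hilbert spaces; it is then unique.\<close>

definition cadjoint :: "('a::complex_inner \<Rightarrow> 'b::complex_inner) \<Rightarrow> 'b \<Rightarrow> 'a" where
  "cadjoint A = (SOME A'. \<forall>x y. cinner (A x) y = cinner x (A' y))"

definition unitary :: "('a::complex_inner \<Rightarrow> 'a) \<Rightarrow> bool" where
  "unitary U \<longleftrightarrow> bounded_clinear U \<and> cadjoint U \<circ> U = id \<and> U \<circ> cadjoint U = id"

definition orthogonal_projection :: "('a::complex_inner \<Rightarrow> 'a) \<Rightarrow> bool" where
  "orthogonal_projection P \<longleftrightarrow> bounded_clinear P \<and> P \<circ> P = P \<and> cadjoint P = P"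

definition eigenspace :: "('a::complex_vector \<Rightarrow> 'a) \<Rightarrow> complex \<Rightarrow> 'a set" where
  "eigenspace A \<mu> = {x. A x = \<mu> *\<^sub>C x}"

definition eigenvalue :: "('a::complex_vector \<Rightarrow> 'a) \<Rightarrow> complex \<Rightarrow> bool" where
  "eigenvalue A \<mu> \<longleftrightarrow> (\<exists>x. x \<noteq> 0 \<and> A x = \<mu> *\<^sub>C x)"

text \<open>Infinite degeneracy counts as even.\<close>

definition even_degeneracy :: "('a::complex_vector \<Rightarrow> 'a) \<Rightarrow> complex \<Rightarrow> bool" where
  "even_degeneracy A \<mu> \<longleftrightarrow>
     (finite_cdim (eigenspace A \<mu>) \<longrightarrow> even (complex_vector.dim (eigenspace A \<mu>)))"

text \<open>The last conjunct says that the range has finite codimension.\<close>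

definition fredholm :: "('a::complex_inner \<Rightarrow> 'b::complex_inner) \<Rightarrow> bool" where
  "fredholm A \<longleftrightarrow> bounded_clinear A \<and> finite_cdim {x. A x = 0} \<and> closed (range A) \<and>
     (\<exists>B. finite B \<and> complex_vector.span (range A \<union> B) = UNIV)"

section \<open>Real structures, symmetry operators and Lagrangian frames\<close>

definition complex_conjugation :: "('a::complex_inner \<Rightarrow> 'a) \<Rightarrow> bool" where
  "complex_conjugation C \<longleftrightarrow>
     (\<forall>x y. C (x + y) = C x + C y) \<and> (\<forall>c x. C (c *\<^sub>C x) = cnj c *\<^sub>C C x) \<and>
     (\<forall>x. norm (C x) = norm x) \<and> C \<circ> C = id"

text \<open>Here \<open>C\<close> is the conjugation of the domain and \<open>D\<close> that of the codomain.\<close>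

definition conj_op :: "('a \<Rightarrow> 'a) \<Rightarrow> ('b \<Rightarrow> 'b) \<Rightarrow> ('a \<Rightarrow> 'b) \<Rightarrow> 'a \<Rightarrow> 'b" where
  "conj_op C D A = D \<circ> A \<circ> C"

definition symmetry_operator :: "('a::complex_inner \<Rightarrow> 'a) \<Rightarrow> ('a \<Rightarrow> 'a) \<Rightarrow> bool" where
  "symmetry_operator C S \<longleftrightarrow>
     S = id \<or>
     unitary S \<and> conj_op C C S = S \<and>
       (S \<circ> S = id \<and> same_hilbert_dim (eigenspace S 1) (eigenspace S (- 1)) \<or>
        S \<circ> S = uminus \<and> same_hilbert_dim (eigenspace S \<i>) (eigenspace S (- \<i>)))"

definition lagrangian_frame ::
  "('k::complex_inner \<Rightarrow> 'k) \<Rightarrow> ('h::complex_inner \<Rightarrow> 'h) \<Rightarrow> ('h \<Rightarrow> 'h) \<Rightarrow> ('k \<Rightarrow> 'h) \<Rightarrow> bool" where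
  "lagrangian_frame C\<^sub>0 C S \<Phi> \<longleftrightarrow>
     bounded_clinear \<Phi> \<and> cadjoint \<Phi> \<circ> \<Phi> = id \<and>
     (\<forall>x. \<Phi> (cadjoint \<Phi> x) +
          (S \<circ> conj_op C\<^sub>0 C \<Phi>) (cadjoint (S \<circ> conj_op C\<^sub>0 C \<Phi>) x) = x)"

end

theory Submission imports Defs begin

text \<open>The antiunitary \<open>K = C S\<^sup>* \<Sigma>\<close> squares to the identity, commutes with \<open>F\<close>, and
  conjugates both \<open>P\<close> and \<open>G = F\<^sup>* Q F\<close> into their complements.  Since the adjoint of
  \<open>S C \<Phi> C\<^sub>0\<close> is \<open>C\<^sub>0 \<Phi>\<^sup>* C S\<^sup>*\<close>, the vector \<open>w\<close> is \<open>A v\<close> for the antilinear map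
  \<open>A = \<Phi>\<^sup>* K G \<Phi>\<close>, while \<open>T\<^sub>0\<^sup>* T\<^sub>0 = \<Phi>\<^sup>* G \<Phi>\<close>.  The algebra of \<open>P\<close>, \<open>G\<close> and \<open>K\<close> shows that \<open>A\<close> preserves
  the eigenspace of \<open>r\<close> and that \<open>A\<^sup>2 = - (r - r\<^sup>2)\<close> there.  As \<open>0 < r < 1\<close>, this is up to scaling a
  quaternionic structure on the eigenspace, which gives both independence and even dimension.\<close>

section \<open>Quaternionic structures\<close>

text \<open>If \<open>J x = k x + u\<close> with \<open>u\<close> in \<open>W\<close>, a second
  application of \<open>J\<close> gives \<open>-c x = |k|^2 x\<close> plus an element of
  \<open>W\<close>. Since \<open>|k|^2 + c > 0\<close>, this puts \<open>x\<close> in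
  \<open>W\<close>. The set is written in the form that \<open>span_insert\<close> produces, so the
  lemma serves both \<open>W = span B\<close> and \<open>W = {0}\<close>.\<close>

lemma antilinear_not_in_span_insert:
  fixes J :: "'a::complex_vector \<Rightarrow> 'a"
  assumes add: "\<And>x y. J (x + y) = J x + J y"
    and scale: "\<And>a x. J (a *\<^sub>C x) = cnj a *\<^sub>C J x"
    and W: "complex_vector.subspace W" "J ` W \<subseteq> W"
    and x: "x \<notin> W" "J (J x) = - (c *\<^sub>R x)" and c: "c > 0"
  shows "J x \<notin> {y. \<exists>k. y - k *\<^sub>C x \<in> W}"
proof
  assume "J x \<in> {y. \<exists>k. y - k *\<^sub>C x \<in> W}"
  then obtain k where k: "J x - k *\<^sub>C x \<in> W" by auto
  define u where "u = J x - k *\<^sub>C x"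
  have u: "u \<in> W" "J x = k *\<^sub>C x + u" using k by (simp_all add: u_def)
  have "J (J x) = cnj k *\<^sub>C J x + J u"
    by (subst u(2)) (simp only: add scale)
  also have "\<dots> = (cnj k * k) *\<^sub>C x + (cnj k *\<^sub>C u + J u)"
    by (simp only: u(2) scaleC_add_right scaleC_scaleC add.assoc)
  finally have "- (complex_of_real c *\<^sub>C x) = (cnj k * k) *\<^sub>C x + (cnj k *\<^sub>C u + J u)"
    by (simp only: x(2) scaleR_scaleC[of c])
  then have eq: "(cnj k * k + complex_of_real c) *\<^sub>C x = - (cnj k *\<^sub>C u + J u)"
    by (metis (no_types) scaleC_add_left add.assoc add.commute add.left_inverse eq_neg_iff_add_eq_0)
  have "- (cnj k *\<^sub>C u + J u) \<in> W"
    using u(1) W by (intro complex_vector.subspace_neg complex_vector.subspace_add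
        complex_vector.subspace_scale) auto
  then have mem: "(cnj k * k + complex_of_real c) *\<^sub>C x \<in> W"
    using eq by simp
  have "Re (cnj k * k + complex_of_real c) = (Re k)\<^sup>2 + (Im k)\<^sup>2 + c"
    by (simp add: power2_eq_square)
  also have "\<dots> > 0" using c by (intro add_nonneg_pos add_nonneg_nonneg zero_le_power2)
  finally have "cnj k * k + complex_of_real c \<noteq> 0" by fastforce
  then have "x = inverse (cnj k * k + complex_of_real c) *\<^sub>C (cnj k * k + complex_of_real c) *\<^sub>C x"
    by (simp add: scaleC_scaleC scaleC_one)
  then show False
    using mem W(1) x(1) complex_vector.subspace_scale by metis
qed

lemma antilinear_image_span:
  fixes J :: "'a::complex_vector \<Rightarrow> 'a"
  assumes add: "\<And>x y. J (x + y) = J x + J y"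
    and scale: "\<And>a x. J (a *\<^sub>C x) = cnj a *\<^sub>C J x"
    and B: "J ` B \<subseteq> complex_vector.span B"
  shows "J ` complex_vector.span B \<subseteq> complex_vector.span B"
proof clarify
  fix x assume "x \<in> complex_vector.span B"
  then show "J x \<in> complex_vector.span B"
  proof (induction rule: complex_vector.span_induct_alt)
    case base
    have "J 0 = 0" using add[of 0 0] by simp
    then show ?case by (simp add: complex_vector.span_zero)
  next
    case (step c x y)
    then show ?case using B
      by (auto simp: add scale intro!: complex_vector.span_add complex_vector.span_scale)
  qed
qed

text \<open>A basis is assembled from pairs \<open>x\<close>, \<open>J x\<close>. The span must stay
  stable under \<open>J\<close> at each stage, since otherwise \<open>J x\<close> could fall into
  the span of the earlier vectors and \<open>x\<close>.\<close>

lemma even_dim_if_quaternionic: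
  fixes J :: "'a::complex_vector \<Rightarrow> 'a"
  assumes add: "\<And>x y. J (x + y) = J x + J y"
    and scale: "\<And>a x. J (a *\<^sub>C x) = cnj a *\<^sub>C J x"
    and E: "complex_vector.subspace E" "J ` E \<subseteq> E" "finite_cdim E"
    and sq: "\<And>x. x \<in> E \<Longrightarrow> J (J x) = - (c *\<^sub>R x)" and c: "c > 0"
  shows "even (complex_vector.dim E)"
proof -
  obtain T where T: "finite T" "E \<subseteq> complex_vector.span T"
    using E(3) by (auto simp: finite_cdim_def)
  define good where "good B \<longleftrightarrow> finite B \<and> complex_vector.independent B \<and> B \<subseteq> E \<and>
    J ` B \<subseteq> complex_vector.span B \<and> even (card B)" for B
  have "good {}"
    by (simp add: good_def complex_vector.independent_empty)
  \<comment> \<open>The finite spanning set bounds all cardinalities, so a \<open>good\<close> set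
    of largest cardinality exists; it is shown to span \<open>E\<close>.\<close>
  have bound: "card B \<le> card T" if "good B" for B
    using complex_vector.independent_span_bound[OF T(1), of B] that T(2) by (auto simp: good_def)
  obtain B where B: "good B" and max: "\<And>B'. good B' \<Longrightarrow> card B' \<le> card B"
    using ex_has_greatest_nat[of good "{}" card "Suc (card T)"] \<open>good {}\<close> bound
    by (metis le_imp_less_Suc)
  let ?W = "complex_vector.span B"
  have JW: "J ` ?W \<subseteq> ?W"
    using B by (intro antilinear_image_span add scale) (auto simp: good_def)
  have "E \<subseteq> ?W"
  proof (rule ccontr)
    assume "\<not> E \<subseteq> ?W"
    then obtain x where x: "x \<in> E" "x \<notin> ?W" by blast
    have "J x \<notin> {y. \<exists>k. y - k *\<^sub>C x \<in> ?W}"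
      by (rule antilinear_not_in_span_insert[OF add scale complex_vector.subspace_span JW x(2) sq[OF x(1)] c])
    then have Jx: "J x \<notin> complex_vector.span (insert x B)"
      by (simp add: complex_vector.span_insert)
    let ?B = "insert (J x) (insert x B)"
    have indep: "complex_vector.independent ?B"
      using B x(2) Jx complex_vector.independent_insertI by (metis good_def)
    have nin: "x \<notin> B" "J x \<notin> insert x B"
      using x(2) Jx complex_vector.span_base[of _ B] complex_vector.span_base[of _ "insert x B"]
      by metis+
    \<comment> \<open>\<open>J\<close> swaps the two new vectors up to the scalar \<open>-c\<close>,
      so the enlarged set is again stable, and its cardinality grows by two.\<close>
    have "J (J x) \<in> complex_vector.span ?B"
      unfolding sq[OF x(1)] scaleR_scaleC
      by (intro complex_vector.span_neg complex_vector.span_scale complex_vector.span_base) auto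
    moreover have "J x \<in> complex_vector.span ?B" by (simp add: complex_vector.span_base)
    moreover have "?W \<subseteq> complex_vector.span ?B" by (intro complex_vector.span_mono) auto
    ultimately have "good ?B"
      using B indep nin x E(2) unfolding good_def by auto
    then show False
      using max[of ?B] nin B by (auto simp: good_def)
  qed
  then have "complex_vector.dim E = card B"
    using B by (intro complex_vector.dim_unique) (auto simp: good_def)
  then show ?thesis using B by (simp add: good_def)
qed

section \<open>Adjoints of bounded operators on Hilbert spaces\<close>

lemma cinner_add_right: "cinner x (y + z) = cinner x y + cinner x z"
  by (metis cinner_add_left cinner_commute complex_cnj_add)

lemma cinner_scaleC_right: "cinner x (c *\<^sub>C y) = c * cinner x y"
  by (metis cinner_scaleC_left cinner_commute complex_cnj_cnj complex_cnj_mult)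

lemma cinner_minus_right: "cinner x (- y) = - cinner x (y :: 'a::complex_inner)"
  using cinner_scaleC_right[of x "- 1" y]
  by (metis complex_vector.scale_minus_left mult_minus1 scaleC_one)

lemma cinner_minus_left: "cinner (- x) y = - cinner (x :: 'a::complex_inner) y"
  by (metis cinner_commute cinner_minus_right complex_cnj_minus)

lemma cinner_diff_right: "cinner x (y - z) = cinner x y - cinner x (z :: 'a::complex_inner)"
  using cinner_add_right[of x y "- z"] by (simp add: cinner_minus_right)

lemma cinner_scaleR_right: "cinner x (r *\<^sub>R y) = complex_of_real r * cinner x y"
  by (simp add: scaleR_scaleC cinner_scaleC_right)

lemma norm_add_squared: "(norm (x + y))\<^sup>2 = (norm x)\<^sup>2 + (norm y)\<^sup>2 + 2 * Re (cinner x (y :: 'a::complex_inner))"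
proof -
  have "complex_of_real ((norm (x + y))\<^sup>2) = cinner x x + cinner y y + (cinner x y + cnj (cinner x y))"
    unfolding cinner_self[symmetric]
    by (simp add: cinner_add_left cinner_add_right cinner_commute[of y x])
  then show ?thesis
    by (simp add: cinner_self complex_eq_iff)
qed

lemma norm_diff_squared: "(norm (x - y))\<^sup>2 = (norm x)\<^sup>2 + (norm y)\<^sup>2 - 2 * Re (cinner x (y :: 'a::complex_inner))"
  using norm_add_squared[of x "- y"] by (simp add: cinner_minus_right)

text \<open>Cauchy-Schwarz for the real part: the norm axioms supply the triangle inequality, and
  squaring it for \<open>x + y\<close> and \<open>x - y\<close> leaves the two signs of this
  bound.\<close>

lemma Re_cinner_le: "\<bar>Re (cinner x y)\<bar> \<le> norm x * norm (y :: 'a::complex_inner)"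
proof -
  have "(norm (x + y))\<^sup>2 \<le> (norm x + norm y)\<^sup>2" "(norm (x - y))\<^sup>2 \<le> (norm x + norm y)\<^sup>2"
    by (intro power_mono norm_triangle_ineq norm_triangle_ineq4 norm_ge_zero)+
  then show ?thesis
    unfolding norm_add_squared norm_diff_squared power2_sum by auto
qed

lemma cinner_eqI:
  fixes x y :: "'a::complex_inner"
  assumes "\<And>u. cinner u x = cinner u y"
  shows "x = y"
proof -
  have "cinner (x - y) (x - y) = 0"
    using assms by (simp add: cinner_diff_right)
  then show ?thesis by (simp add: cinner_self)
qed

text \<open>The representing vector minimises \<open>\<parallel>x\<parallel>\<^sup>2 - 2 f x\<close>; minimising sequences are Cauchy by the
  parallelogram identity.\<close>

lemma riesz_representation_Re:
  fixes f :: "'a::chilbert_space \<Rightarrow> real"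
  assumes f: "bounded_linear f"
  obtains z where "\<And>x. f x = Re (cinner z x)"
proof -
  interpret f: bounded_linear f by (rule f)
  define J where "J x = (norm x)\<^sup>2 - 2 * f x" for x
  obtain M where M: "\<And>x. norm (f x) \<le> norm x * M"
    using f.bounded by blast
  have lower: "- M\<^sup>2 \<le> J x" for x
  proof -
    have "0 \<le> (norm x - M)\<^sup>2" by simp
    then show ?thesis using M[of x] by (simp add: J_def power2_diff)
  qed
  then have bdd: "bdd_below (range J)" by (intro bdd_belowI2)
  define m where "m = Inf (range J)"
  have m: "m \<le> J x" for x
    unfolding m_def by (intro cInf_lower bdd) auto
  have "\<exists>x. J x < m + 1 / Suc n" for n
    using cInf_lessD[of "range J" "m + 1 / Suc n"] by (auto simp: m_def)
  then obtain X where X: "\<And>n. J (X n) < m + 1 / Suc n" by metis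
  \<comment> \<open>The \<open>f\<close> terms cancel by linearity. As the value at the midpoint is
    at least \<open>m\<close>, two points with values near \<open>m\<close> are close
    together.\<close>
  have par: "(norm (x - y))\<^sup>2 = 2 * J x + 2 * J y - 4 * J ((1/2) *\<^sub>R (x + y))" for x y
  proof -
    have half: "(norm ((1/2) *\<^sub>R (x + y)))\<^sup>2 = ((norm x)\<^sup>2 + (norm y)\<^sup>2 + 2 * Re (cinner x y)) / 4"
      unfolding norm_add_squared[symmetric] by (simp add: power_divide)
    show ?thesis
      unfolding J_def half norm_diff_squared f.scaleR f.add by (simp add: field_simps)
  qed
  have dist: "(norm (X i - X j))\<^sup>2 \<le> 4 / Suc N" if "i \<ge> N" "j \<ge> N" for i j N
  proof -
    have "1 / real (Suc i) \<le> 1 / Suc N" "1 / real (Suc j) \<le> 1 / Suc N"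
      using that by (simp_all add: frac_le)
    then show ?thesis
      using par[of "X i" "X j"] X[of i] X[of j] m[of "(1/2) *\<^sub>R (X i + X j)"] by linarith
  qed
  have "Cauchy X"
  proof (rule CauchyI)
    fix e :: real assume e: "e > 0"
    obtain N where N: "inverse (real (Suc N)) < e\<^sup>2 / 4"
      using reals_Archimedean[of "e\<^sup>2 / 4"] e zero_less_power by (metis divide_pos_pos zero_less_numeral)
    have "norm (X i - X j) < e" if "i \<ge> N" "j \<ge> N" for i j
    proof (rule power_less_imp_less_base)
      show "(norm (X i - X j))\<^sup>2 < e\<^sup>2"
        using dist[OF that] N unfolding inverse_eq_divide by linarith
    qed (use e in simp)
    then show "\<exists>M. \<forall>m\<ge>M. \<forall>n\<ge>M. norm (X m - X n) < e" by blast
  qed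
  then obtain z where z: "X \<longlonglongrightarrow> z"
    by (metis Cauchy_convergent_iff convergent_def)
  have lim: "(\<lambda>n. J (X n)) \<longlonglongrightarrow> J z"
    unfolding J_def by (intro tendsto_intros f.tendsto z)
  have "(\<lambda>n. m + 1 / real (Suc n)) \<longlonglongrightarrow> m + 0"
    by (intro tendsto_add tendsto_const LIMSEQ_Suc[OF lim_const_over_n])
  then have "J z \<le> m + 0"
    using X less_imp_le by (intro LIMSEQ_le[OF lim]) blast+
  then have min: "J z \<le> J x" for x using m[of x] by linarith
  \<comment> \<open>First variation at the minimiser in direction \<open>h\<close>, with defect
    \<open>a\<close>. The summand 1 in \<open>N\<close> covers \<open>h = 0\<close>; the step
    \<open>t = a / N\<close> turns minimality into \<open>2 t a \<le> t a\<close>, hence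
    \<open>a = 0\<close>.\<close>
  have "f h = Re (cinner z h)" for h
  proof -
    define a where "a = f h - Re (cinner z h)"
    define N where "N = (norm h)\<^sup>2 + 1"
    have N: "N > 0" by (simp add: N_def add_nonneg_pos)
    define t where "t = a / N"
    have "J (z + t *\<^sub>R h) = J z + t\<^sup>2 * (norm h)\<^sup>2 - 2 * t * a"
      unfolding J_def norm_add_squared a_def
      by (simp add: f.add f.scaleR cinner_scaleR_right power_mult_distrib algebra_simps)
    then have "2 * t * a \<le> t\<^sup>2 * (norm h)\<^sup>2" using min[of "z + t *\<^sub>R h"] by linarith
    also have "\<dots> \<le> t\<^sup>2 * N" by (simp add: N_def mult_left_mono)
    also have "\<dots> = t * a" using N by (simp add: t_def power2_eq_square)
    finally have "t * a \<le> 0" by linarith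
    moreover have "t * a = a\<^sup>2 / N" by (simp add: t_def power2_eq_square)
    ultimately have "a\<^sup>2 \<le> 0" using N by (simp add: divide_le_0_iff)
    then show ?thesis by (simp add: a_def)
  qed
  then show ?thesis using that by blast
qed

text \<open>The relational form bypasses the choice in \<open>cadjoint\<close>: a candidate is
  checked against the inner product, and \<open>cadjoint_eq\<close> then identifies it.\<close>

definition is_adjoint :: "('a::complex_inner \<Rightarrow> 'b::complex_inner) \<Rightarrow> ('b \<Rightarrow> 'a) \<Rightarrow> bool" where
  "is_adjoint A B \<longleftrightarrow> (\<forall>x y. cinner (A x) y = cinner x (B y))"

lemma is_adjointD: "is_adjoint A B \<Longrightarrow> cinner (A x) y = cinner x (B y)"
  by (simp add: is_adjoint_def)

lemma is_adjoint_commute: "is_adjoint A B \<Longrightarrow> is_adjoint B A"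
  by (metis cinner_commute is_adjoint_def)

lemma is_adjointD': "is_adjoint A B \<Longrightarrow> cinner y (A x) = cinner (B y) x"
  by (metis cinner_commute is_adjoint_def)

lemma cadjoint_eq:
  assumes "is_adjoint A B"
  shows "cadjoint A = B"
proof -
  have "is_adjoint A (cadjoint A)"
    using assms someI[of "is_adjoint A" B] unfolding is_adjoint_def cadjoint_def by fast
  then have "cadjoint A y = B y" for y
    using assms by (intro cinner_eqI) (metis is_adjoint_def)
  then show ?thesis by blast
qed

lemma bounded_clinear_scaleC: "bounded_clinear A \<Longrightarrow> A (c *\<^sub>C x) = c *\<^sub>C A x"
  and bounded_clinear_add: "bounded_clinear A \<Longrightarrow> A (x + y) = A x + A y"
  and bounded_clinear_diff: "bounded_clinear A \<Longrightarrow> A (x - y) = A x - A y"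
  and bounded_clinear_scaleR: "bounded_clinear A \<Longrightarrow> A (r *\<^sub>R x) = r *\<^sub>R A x"
  by (auto simp: bounded_clinear_def linear_add linear_diff linear_scale
      dest: bounded_linear.linear)

text \<open>The real Riesz theorem represents the real part of \<open>cinner y (A x)\<close>.
  Replacing \<open>x\<close> by \<open>\<i> *\<^sub>C x\<close> recovers the imaginary part, by
  complex linearity of \<open>A\<close>.\<close>

lemma is_adjoint_cadjoint:
  fixes A :: "'a::chilbert_space \<Rightarrow> 'b::complex_inner"
  assumes A: "bounded_clinear A"
  shows "is_adjoint A (cadjoint A)"
proof -
  have bl: "bounded_linear A" using A by (simp add: bounded_clinear_def)
  obtain M where M: "\<And>x. norm (A x) \<le> norm x * M"
    using bounded_linear.bounded[OF bl] by blast
  have "\<exists>z. \<forall>x. cinner (A x) y = cinner x z" for y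
  proof -
    have "bounded_linear (\<lambda>x. Re (cinner y (A x)))"
    proof (rule bounded_linear_intro)
      show "norm (Re (cinner y (A x))) \<le> norm x * (norm y * M)" for x
        using Re_cinner_le[of y "A x"] mult_left_mono[OF M[of x], of "norm y"]
        by (simp add: algebra_simps)
    qed (simp_all add: A bounded_clinear_add bounded_clinear_scaleR cinner_add_right cinner_scaleR_right)
    then obtain z where z: "\<And>x. Re (cinner y (A x)) = Re (cinner z x)"
      by (rule riesz_representation_Re) blast
    have "Im (cinner y (A x)) = Im (cinner z x)" for x
      using z[of "\<i> *\<^sub>C x"] by (simp add: A bounded_clinear_scaleC cinner_scaleC_right)
    with z have "cinner y (A x) = cinner z x" for x
      by (simp add: complex_eq_iff)
    then show ?thesis by (metis cinner_commute)
  qed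
  then obtain B where "is_adjoint A B" unfolding is_adjoint_def by metis
  then show ?thesis using cadjoint_eq by metis
qed

lemma is_adjoint_add:
  assumes "is_adjoint A B"
  shows "B (x + y) = B x + B y"
  by (rule cinner_eqI) (simp add: cinner_add_right is_adjointD[OF assms, symmetric])

lemma is_adjoint_diff:
  assumes "is_adjoint A B"
  shows "B (x - y) = B x - B y"
  by (rule cinner_eqI) (simp add: cinner_diff_right is_adjointD[OF assms, symmetric])

lemma is_adjoint_scaleC:
  assumes "is_adjoint A B"
  shows "B (c *\<^sub>C x) = c *\<^sub>C B x"
  by (rule cinner_eqI) (simp add: cinner_scaleC_right is_adjointD[OF assms, symmetric])

lemma is_adjoint_scaleR: "is_adjoint A B \<Longrightarrow> B (r *\<^sub>R x) = r *\<^sub>R B x"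
  by (simp add: scaleR_scaleC is_adjoint_scaleC)

text \<open>Symmetry and idempotence turn the squared norm of \<open>B x\<close> into
  \<open>cinner x (B x)\<close>, and Cauchy-Schwarz finishes. Applied to \<open>P\<close> and
  \<open>G\<close>, this bounds the eigenvalues by 1.\<close>

lemma norm_symmetric_idempotent_le:
  fixes B :: "'a::complex_inner \<Rightarrow> 'a"
  assumes "is_adjoint B B" "B (B x) = B x"
  shows "norm (B x) \<le> norm x"
proof -
  have "cinner (B x) (B x) = cinner x (B x)"
    using assms by (simp add: is_adjointD)
  then have "(norm (B x))\<^sup>2 = Re (cinner x (B x))"
    by (simp add: cinner_self complex_eq_iff)
  also have "\<dots> \<le> norm x * norm (B x)"
    using Re_cinner_le[of x "B x"] by simp
  finally show ?thesis
    by (cases "B x = 0") (simp_all add: power2_eq_square)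
qed

section \<open>Conjugations and symmetry operators\<close>

text \<open>Isometry preserves real parts by polarization, and antilinearity flips imaginary parts.
  The involution then gives this swapped form, the antilinear analogue of self-adjointness.\<close>

lemma complex_conjugation_cinner:
  assumes C: "complex_conjugation C"
  shows "cinner (C x) y = cinner (C y) x"
proof -
  have add: "C (x + y) = C x + C y" and scale: "C (c *\<^sub>C x) = cnj c *\<^sub>C C x"
    and norm: "norm (C x) = norm x" and inv: "C (C x) = x" for x y c
    using C by (auto simp: complex_conjugation_def fun_eq_iff)
  have Re: "Re (cinner (C x) (C y)) = Re (cinner x y)" for x y
    using norm_add_squared[of "C x" "C y"] norm_add_squared[of x y]
    by (simp add: norm add[symmetric])
  have "Im (cinner (C x) (C y)) = - Im (cinner x y)" for x y
    using Re[of "\<i> *\<^sub>C x" y] by (simp add: scale cinner_scaleC_left cinner_minus_left)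
  then have "cinner (C x) (C y) = cnj (cinner x y)" for x y
    using Re by (simp add: complex_eq_iff)
  then show ?thesis by (metis inv cinner_commute)
qed

lemma symmetry_operator_unitary:
  "symmetry_operator C S \<Longrightarrow> unitary S"
proof -
  have "cadjoint (id :: 'a \<Rightarrow> 'a) = id"
    by (rule cadjoint_eq) (simp add: is_adjoint_def)
  then have "unitary (id :: 'a \<Rightarrow> 'a)"
    by (simp add: unitary_def bounded_clinear_def bounded_linear_ident id_def comp_def)
  then show "symmetry_operator C S \<Longrightarrow> unitary S"
    by (auto simp: symmetry_operator_def)
qed

lemma symmetry_operator_commute:
  assumes "complex_conjugation C" "symmetry_operator C S"
  shows "C (S x) = S (C x)"
proof -
  have "C (C x) = x" for x
    using assms(1) by (auto simp: complex_conjugation_def fun_eq_iff)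
  moreover have "C (S (C x)) = S x" for x
    using assms(2) calculation by (auto simp: symmetry_operator_def conj_op_def fun_eq_iff)
  ultimately show ?thesis by metis
qed

theorem proposition7:
  fixes C :: "'h::chilbert_space \<Rightarrow> 'h"
    and C\<^sub>0 :: "'k::chilbert_space \<Rightarrow> 'k"
    and C\<^sub>1 :: "'l::chilbert_space \<Rightarrow> 'l"
    and \<eta> :: real
    and S \<Sigma> P Q F :: "'h \<Rightarrow> 'h"
    and \<Phi> :: "'k \<Rightarrow> 'h" and \<Psi> :: "'l \<Rightarrow> 'h" and T\<^sub>0 :: "'k \<Rightarrow> 'l"
  assumes C: "complex_conjugation C" and C0: "complex_conjugation C\<^sub>0"
    and C1: "complex_conjugation C\<^sub>1"
    and eta: "\<eta> \<in> {- 1, 1}"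
    and S: "symmetry_operator C S" and Sigma: "symmetry_operator C \<Sigma>"
    and S_Sigma: "S \<circ> \<Sigma> = \<Sigma> \<circ> S"
    and S_sq: "S \<circ> S = (\<lambda>x. \<eta> *\<^sub>R x)" and Sigma_sq: "\<Sigma> \<circ> \<Sigma> = (\<lambda>x. \<eta> *\<^sub>R x)"
    and P: "orthogonal_projection P" and Q: "orthogonal_projection Q"
    and S_P: "cadjoint S \<circ> conj_op C C P \<circ> S = (\<lambda>x. x - P x)"
    and S_Q: "cadjoint S \<circ> conj_op C C Q \<circ> S = (\<lambda>x. x - Q x)"
    and Sigma_P: "\<Sigma> \<circ> P = P \<circ> \<Sigma>" and Sigma_Q: "\<Sigma> \<circ> Q = Q \<circ> \<Sigma>"
    and F: "unitary F"
    and Sigma_F: "cadjoint \<Sigma> \<circ> conj_op C C F \<circ> \<Sigma> = F"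
    and S_F: "S \<circ> F = F \<circ> S"
    and T: "fredholm (\<lambda>x. P (F (P x)) + (x - P x))"
    and Phi: "lagrangian_frame C\<^sub>0 C S \<Phi>" and P_Phi: "P = \<Phi> \<circ> cadjoint \<Phi>"
    and Psi: "lagrangian_frame C\<^sub>1 C S \<Psi>" and Q_Psi: "Q = \<Psi> \<circ> cadjoint \<Psi>"
    and T0: "T\<^sub>0 = cadjoint \<Psi> \<circ> F \<circ> \<Phi>"
  shows "(\<forall>v w. \<forall>r::real. v \<noteq> 0 \<longrightarrow> r > 0 \<longrightarrow> (cadjoint T\<^sub>0 \<circ> T\<^sub>0) v = r *\<^sub>R v \<longrightarrow>
            w = C\<^sub>0 (cadjoint (S \<circ> conj_op C\<^sub>0 C \<Phi>)
                      (\<Sigma> (cadjoint F (\<Psi> (cadjoint \<Psi> (F (\<Phi> v))))))) \<longrightarrow>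
            (r \<noteq> 1 \<longrightarrow> w \<noteq> v \<and> complex_vector.independent {v, w}) \<and>
            (cadjoint T\<^sub>0 \<circ> T\<^sub>0) w = r *\<^sub>R w)
       \<and> (\<forall>\<mu>. eigenvalue (cadjoint T\<^sub>0 \<circ> T\<^sub>0) \<mu> \<longrightarrow> \<mu> \<noteq> 0 \<longrightarrow> \<mu> \<noteq> 1 \<longrightarrow>
            even_degeneracy (cadjoint T\<^sub>0 \<circ> T\<^sub>0) \<mu>)"
proof -
  note lin = bounded_clinear_add bounded_clinear_diff bounded_clinear_scaleR bounded_clinear_scaleC
  note adj = is_adjoint_add is_adjoint_diff is_adjoint_scaleR is_adjoint_scaleC
  have uS: "unitary S" and uSig: "unitary \<Sigma>"
    using S Sigma by (simp_all add: symmetry_operator_unitary)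
  have bS: "bounded_clinear S" and bSig: "bounded_clinear \<Sigma>" and bF: "bounded_clinear F"
    and bP: "bounded_clinear P" and bQ: "bounded_clinear Q"
    and bPhi: "bounded_clinear \<Phi>" and bPsi: "bounded_clinear \<Psi>"
    using uS uSig F P Q Phi Psi
    by (simp_all add: unitary_def orthogonal_projection_def lagrangian_frame_def)
  note aS = is_adjoint_cadjoint[OF bS] and aF = is_adjoint_cadjoint[OF bF]
    and aPhi = is_adjoint_cadjoint[OF bPhi] and aPsi = is_adjoint_cadjoint[OF bPsi]
  have aP: "is_adjoint P P" and aQ: "is_adjoint Q Q"
    using is_adjoint_cadjoint[OF bP] is_adjoint_cadjoint[OF bQ] P Q
    by (simp_all add: orthogonal_projection_def)
  have PP: "P (P x) = P x" and QQ: "Q (Q x) = Q x" for x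
    using P Q by (auto simp: orthogonal_projection_def fun_eq_iff)
  have FF: "cadjoint F (F x) = x" "F (cadjoint F x) = x" for x
    using F by (auto simp: unitary_def fun_eq_iff)
  have Cadd: "C (x + y) = C x + C y" and Cscale: "C (c *\<^sub>C x) = cnj c *\<^sub>C C x"
    and CC: "C (C x) = x" for x y c
    using C by (auto simp: complex_conjugation_def fun_eq_iff)
  have CscaleR: "C (r *\<^sub>R x) = r *\<^sub>R C x" for r x
    by (simp add: scaleR_scaleC Cscale)
  have C0C0: "C\<^sub>0 (C\<^sub>0 x) = x" for x
    using C0 by (auto simp: complex_conjugation_def fun_eq_iff)
  have CS: "C (S x) = S (C x)" and CSig: "C (\<Sigma> x) = \<Sigma> (C x)" for x
    by (simp_all add: symmetry_operator_commute[OF C] S Sigma)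
  have \<eta>\<eta>: "\<eta> * \<eta> = 1" using eta by auto
  have SS: "S (S x) = \<eta> *\<^sub>R x" and SigSig: "\<Sigma> (\<Sigma> x) = \<eta> *\<^sub>R x"
    and SSig: "S (\<Sigma> x) = \<Sigma> (S x)" for x
    using S_sq Sigma_sq S_Sigma by (auto simp: fun_eq_iff)
  \<comment> \<open>As \<open>\<eta> * \<eta> = 1\<close>, the inverse of \<open>U\<close> is
    \<open>\<eta> U\<close>, and unitarity makes it the adjoint. This removes the adjoints of
    \<open>S\<close> and \<open>\<Sigma>\<close> from the calculations.\<close>
  have inverse_eq: "cadjoint U x = \<eta> *\<^sub>R U x"
    if U: "unitary U" "\<And>x. U (U x) = \<eta> *\<^sub>R x" for U :: "'h \<Rightarrow> 'h" and x
  proof -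
    have "x = U (\<eta> *\<^sub>R U x)"
      using U \<eta>\<eta> by (simp add: unitary_def bounded_clinear_scaleR)
    then show ?thesis
      using U(1) unfolding unitary_def by (metis comp_apply id_apply)
  qed
  note S_adj = inverse_eq[OF uS SS] and Sig_adj = inverse_eq[OF uSig SigSig]

  \<comment> \<open>The antiunitary \<open>K\<close> and its commutation relations\<close>
  define K where "K x = \<eta> *\<^sub>R S (\<Sigma> (C x))" for x
  define G where "G x = cadjoint F (Q (F x))" for x
  have K_eq: "C (cadjoint S (\<Sigma> x)) = K x" for x
    by (simp add: K_def S_adj CscaleR CS CSig)
  have Kadd: "K (x + y) = K x + K y" and KscaleC: "K (c *\<^sub>C x) = cnj c *\<^sub>C K x" for x y c
    using bS bSig by (simp_all add: K_def Cadd Cscale lin scaleC_add_right scaleC_scaleC scaleR_scaleC mult.commute)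
  have KscaleR: "K (r *\<^sub>R x) = r *\<^sub>R K x" for r x
    by (simp add: scaleR_scaleC KscaleC)
  have Kdiff: "K (x - y) = K x - K y" for x y
    using Kadd[of x "(- 1) *\<^sub>R y"] KscaleR[of "- 1" y] by simp
  \<comment> \<open>Equal signs of the two squares matter here: \<open>S\<close> and
    \<open>\<Sigma>\<close> commute, so the square of \<open>S \<Sigma>\<close> is
    \<open>\<eta> * \<eta> = 1\<close>.\<close>
  have KK: "K (K x) = x" for x
  proof -
    have "K (K x) = (\<eta> * \<eta>) *\<^sub>R S (\<Sigma> (S (\<Sigma> x)))"
      using bS bSig by (simp add: K_def CscaleR CS CSig CC lin)
    also have "\<dots> = (\<eta> * \<eta>) *\<^sub>R x"
      using bS bSig SS SigSig \<eta>\<eta> by (simp add: SSig[symmetric] lin)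
    finally show ?thesis using \<eta>\<eta> by simp
  qed
  \<comment> \<open>Multiplying the hypothesis on \<open>R\<close> by \<open>C S\<close> shows that
    \<open>C S\<close> exchanges \<open>R\<close> with its complement. The factor
    \<open>\<Sigma>\<close> commutes with \<open>R\<close>, so \<open>K\<close> inherits this
    exchange.\<close>
  have K_projection: "K (R x) = K x - R (K x)"
    if R: "bounded_clinear R" "cadjoint S \<circ> conj_op C C R \<circ> S = (\<lambda>x. x - R x)" "\<Sigma> \<circ> R = R \<circ> \<Sigma>"
    for R and x
  proof -
    have "\<eta> *\<^sub>R S (C (R (C (S y)))) = y - R y" for y
      using fun_cong[OF R(2), of y] by (simp add: conj_op_def S_adj)
    then have "C (S (\<eta> *\<^sub>R S (C (R (C (S y)))))) = C (S (y - R y))" for y by simp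
    then have "R (C (S y)) = C (S (y - R y))" for y
      using bS SS \<eta>\<eta> by (simp add: lin CscaleR CC)
    moreover have "C (S (y - R y)) + C (S (R y)) = C (S y)" for y
      using bS by (simp add: lin flip: Cadd)
    ultimately have *: "C (S (R y)) = C (S y) - R (C (S y))" for y
      by (metis add_diff_cancel_left')
    have "K (R x) = \<eta> *\<^sub>R C (S (R (\<Sigma> x)))"
      using R(3) by (simp add: K_def CS fun_eq_iff flip: CSig)
    then show ?thesis
      using R(1) unfolding * by (simp add: K_def CS CSig lin scaleR_diff_right)
  qed
  have KP: "K (P x) = K x - P (K x)" and KQ: "K (Q x) = K x - Q (K x)" for x
    by (simp_all add: K_projection bP S_P Sigma_P bQ S_Q Sigma_Q)
  \<comment> \<open>The reality condition says that \<open>\<Sigma> C\<close> commutes with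
    \<open>F\<close>; the remaining factor \<open>S\<close> commutes with \<open>F\<close> by
    hypothesis.\<close>
  have KF: "K (F x) = F (K x)" for x
  proof -
    have "\<eta> *\<^sub>R \<Sigma> (C (F (C (\<Sigma> x)))) = F x" for x
      using fun_cong[OF Sigma_F, of x] by (simp add: conj_op_def Sig_adj)
    then have "\<Sigma> (F x) = \<Sigma> (\<eta> *\<^sub>R \<Sigma> (C (F (C (\<Sigma> x)))))" by simp
    also have "\<dots> = C (F (C (\<Sigma> x)))"
      using bSig \<eta>\<eta> by (simp add: lin SigSig)
    finally have "\<Sigma> (C (F x)) = F (\<Sigma> (C x))"
      by (metis CC CSig)
    moreover have "S (F y) = F (S y)" for y
      using S_F by (auto simp: fun_eq_iff)
    ultimately show ?thesis
      using bF by (simp add: K_def lin)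
  qed
  have KF': "K (cadjoint F x) = cadjoint F (K x)" for x
    by (metis KF FF)
  have KG: "K (G x) = K x - G (K x)" for x
    using aF by (simp add: G_def KF' KQ KF adj FF)
  have Gdiff: "G (x - y) = G x - G y" and Gadd: "G (x + y) = G x + G y"
    and GscaleR: "G (r *\<^sub>R x) = r *\<^sub>R G x" and GscaleC: "G (c *\<^sub>C x) = c *\<^sub>C G x" for x y r c
    using aF bQ bF by (simp_all add: G_def adj lin)
  have GG: "G (G x) = G x" for x
    by (simp add: G_def FF QQ)
  have aG: "is_adjoint G G"
    by (simp add: is_adjoint_def G_def is_adjointD[OF aF] is_adjointD[OF aQ]
        is_adjointD[OF is_adjoint_commute[OF aF]])

  \<comment> \<open>Two identities for the projections \<open>P\<close> and \<open>G\<close>\<close>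
  have eigen_image: "P (G (P (K (G x)))) = r *\<^sub>R P (K (G x))"
    if x: "P x = x" "P (G x) = r *\<^sub>R x" for x r
  proof -
    \<comment> \<open>With these two rules both sides reduce to
      \<open>r K (G x - r x)\<close>.\<close>
    have "P (K u) = K (u - P u)" for u by (simp add: Kdiff KP)
    moreover have "G (K u) = K (u - G u)" for u by (simp add: Kdiff KG)
    ultimately show ?thesis
      using bP by (simp add: lin Gdiff GG GscaleR x scaleR_diff_right KscaleR flip: KscaleR)
  qed
  \<comment> \<open>Here \<open>P K G x = K (G x - r x)\<close>, and \<open>K G K = 1 - G\<close>
    maps \<open>G x - r x\<close> to \<open>r (G x - x)\<close>, whose image under \<open>P\<close>
    is \<open>(r\<^sup>2 - r) x\<close>.\<close>
  have square: "P (K (G (P (K (G x))))) = - ((r - r\<^sup>2) *\<^sub>R x)"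
    if x: "P x = x" "P (G x) = r *\<^sub>R x" for x r
    using bP Gdiff[of 0 0] bounded_clinear_diff[OF bP, of 0 0]
    by (simp add: KG KP KK Kdiff lin Gdiff GG GscaleR KscaleR x scaleR_diff_left power2_eq_square)

  \<comment> \<open>Transfer to the frames\<close>
  have P_apply: "P x = \<Phi> (cadjoint \<Phi> x)" and Q_apply: "Q x = \<Psi> (cadjoint \<Psi> x)" for x
    by (simp_all add: P_Phi Q_Psi)
  have PhiPhi: "cadjoint \<Phi> (\<Phi> x) = x" for x
    using Phi by (auto simp: lagrangian_frame_def fun_eq_iff)
  have aT: "is_adjoint T\<^sub>0 (\<lambda>y. cadjoint \<Phi> (cadjoint F (\<Psi> y)))"
    by (simp add: is_adjoint_def T0 is_adjointD[OF aPhi] is_adjointD[OF aF]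
        is_adjointD[OF is_adjoint_commute[OF aPsi]])
  define R where "R = cadjoint T\<^sub>0 \<circ> T\<^sub>0"
  have R: "R v = cadjoint \<Phi> (G (\<Phi> v))" for v
    unfolding R_def cadjoint_eq[OF aT] by (simp add: T0 G_def Q_apply)
  define A where "A v = cadjoint \<Phi> (K (G (\<Phi> v)))" for v
  \<comment> \<open>Each conjugation swaps the arguments of the inner product; the swaps from
    \<open>C\<close> and \<open>C\<^sub>0\<close> cancel.\<close>
  have "is_adjoint (S \<circ> conj_op C\<^sub>0 C \<Phi>) (\<lambda>y. C\<^sub>0 (cadjoint \<Phi> (C (cadjoint S y))))"
    unfolding is_adjoint_def
  proof (intro allI)
    fix x y
    have "cinner ((S \<circ> conj_op C\<^sub>0 C \<Phi>) x) y = cinner (C (\<Phi> (C\<^sub>0 x))) (cadjoint S y)"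
      by (simp add: conj_op_def is_adjointD[OF aS])
    also have "\<dots> = cinner (cadjoint \<Phi> (C (cadjoint S y))) (C\<^sub>0 x)"
      by (simp add: complex_conjugation_cinner[OF C, of "\<Phi> _"] is_adjointD'[OF aPhi])
    also have "\<dots> = cinner x (C\<^sub>0 (cadjoint \<Phi> (C (cadjoint S y))))"
      by (metis complex_conjugation_cinner[OF C0] cinner_commute)
    finally show "cinner ((S \<circ> conj_op C\<^sub>0 C \<Phi>) x) y = cinner x (C\<^sub>0 (cadjoint \<Phi> (C (cadjoint S y))))" .
  qed
  then have A: "C\<^sub>0 (cadjoint (S \<circ> conj_op C\<^sub>0 C \<Phi>)
      (\<Sigma> (cadjoint F (\<Psi> (cadjoint \<Psi> (F (\<Phi> v))))))) = A v" for v
    by (simp add: cadjoint_eq C0C0 K_eq A_def G_def Q_apply)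
  have Aadd: "A (x + y) = A x + A y" and AscaleC: "A (c *\<^sub>C x) = cnj c *\<^sub>C A x" for x y c
    using bPhi aPhi by (simp_all add: A_def adj lin Gadd Kadd GscaleC KscaleC)
  \<comment> \<open>Since \<open>P (G (\<Phi> v)) = \<Phi> (R v)\<close>, an eigenvector
    \<open>v\<close> of \<open>R\<close> yields a vector \<open>\<Phi> v\<close> of the kind treated
    above. Applying the adjoint of \<open>\<Phi>\<close> brings the two identities back to
    \<open>A\<close>.\<close>
  have eigen: "P (\<Phi> v) = \<Phi> v" "P (G (\<Phi> v)) = r *\<^sub>R \<Phi> v" if "R v = r *\<^sub>R v" for v r
    using that bPhi unfolding P_apply R PhiPhi by (simp_all add: lin)
  have RA: "R (A v) = r *\<^sub>R A v" if v: "R v = r *\<^sub>R v" for v r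
    using arg_cong[OF eigen_image[OF eigen[OF v]], of "cadjoint \<Phi>"] bPhi aPhi
    by (simp add: R A_def P_apply PhiPhi adj lin)
  have AA: "A (A v) = - ((r - r\<^sup>2) *\<^sub>R v)" if v: "R v = r *\<^sub>R v" for v r
    using arg_cong[OF square[OF eigen[OF v]], of "cadjoint \<Phi>"] bPhi aPhi
    by (simp add: A_def P_apply PhiPhi adj lin flip: scaleR_minus_left)
  \<comment> \<open>\<open>P\<close> and \<open>G\<close> are contractions, so
    \<open>r \<le> 1\<close>. The value \<open>r = 1\<close> is a true exception: equality of norms
    forces \<open>G (\<Phi> v) = \<Phi> v\<close>, and as \<open>P K P = 0\<close> this gives
    \<open>A v = 0\<close>.\<close>
  have r_bound: "r - r\<^sup>2 > 0" if v: "R v = r *\<^sub>R v" "v \<noteq> 0" and r: "r > 0" "r \<noteq> 1" for v r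
  proof -
    have "\<Phi> v \<noteq> 0" using v(2) PhiPhi bPhi by (metis bounded_clinear_diff diff_self)
    moreover have "norm (r *\<^sub>R \<Phi> v) \<le> norm (\<Phi> v)"
      unfolding eigen(2)[OF v(1), symmetric]
      using norm_symmetric_idempotent_le[OF aP PP] norm_symmetric_idempotent_le[OF aG GG]
      by (rule order_trans)
    ultimately have "r < 1" using r by simp
    then show ?thesis using r by (simp add: power2_eq_square)
  qed
  have indep: "A v \<noteq> v \<and> complex_vector.independent {v, A v}"
    if v: "R v = r *\<^sub>R v" "v \<noteq> 0" and r: "r > 0" "r \<noteq> 1" for v r
  proof -
    have "A 0 = 0" using Aadd[of 0 0] by simp
    then have "A v \<notin> {y. \<exists>k. y - k *\<^sub>C v \<in> {0}}"
      using v by (intro antilinear_not_in_span_insert[OF Aadd AscaleC _ _ _ AA[OF v(1)] r_bound[OF v r]])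
        auto
    then have "A v \<notin> complex_vector.span {v}" by (simp add: complex_vector.span_insert)
    moreover from this have "A v \<noteq> v" using complex_vector.span_base[of v "{v}"] by auto
    moreover have "complex_vector.independent {v}"
      using v(2) by (simp add: complex_vector.independent_insert complex_vector.independent_empty)
    ultimately have "complex_vector.independent {A v, v}"
      using complex_vector.independent_insertI by blast
    then show ?thesis using \<open>A v \<noteq> v\<close> by (metis insert_commute)
  qed

  \<comment> \<open>Even degeneracy\<close>
  have even: "even_degeneracy R \<mu>" if mu: "eigenvalue R \<mu>" "\<mu> \<noteq> 0" "\<mu> \<noteq> 1" for \<mu>
  proof -
    obtain v where v: "v \<noteq> 0" "R v = \<mu> *\<^sub>C v"
      using mu(1) by (auto simp: eigenvalue_def)
    \<comment> \<open>The Rayleigh quotient of \<open>v\<close>: it shows that the complex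
      eigenvalue \<open>\<mu>\<close> is real and, being nonzero, positive.\<close>
    define r where "r = (norm (T\<^sub>0 v))\<^sup>2 / (norm v)\<^sup>2"
    have "\<mu> * cinner v v = cinner v (R v)" by (simp add: v(2) cinner_scaleC_right)
    also have "\<dots> = cinner (T\<^sub>0 v) (T\<^sub>0 v)"
      by (simp add: R_def cadjoint_eq[OF aT] is_adjointD[OF aT])
    finally have mu_r: "\<mu> = complex_of_real r"
      using v(1) by (simp add: cinner_self r_def field_simps)
    have r: "r > 0" "r \<noteq> 1"
      using mu(2,3) mu_r by (auto simp: r_def zero_less_divide_iff)
    have eig: "x \<in> eigenspace R \<mu> \<longleftrightarrow> R x = r *\<^sub>R x" for x
      by (simp add: eigenspace_def mu_r scaleR_scaleC)
    have Radd: "R (x + y) = R x + R y" and RscaleC: "R (c *\<^sub>C x) = c *\<^sub>C R x" for x y c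
      using bPhi aPhi by (simp_all add: R adj lin Gadd GscaleC)
    have "complex_vector.subspace (eigenspace R \<mu>)"
      using Radd[of 0 0]
      by (intro complex_vector.subspaceI)
        (auto simp: eigenspace_def Radd RscaleC scaleC_add_right scaleC_scaleC mult.commute)
    moreover have "A ` eigenspace R \<mu> \<subseteq> eigenspace R \<mu>"
      using RA by (auto simp: eig)
    moreover have "r - r\<^sup>2 > 0"
      using v r by (intro r_bound[of v]) (simp_all add: mu_r scaleR_scaleC)
    ultimately show ?thesis
      unfolding even_degeneracy_def
      using even_dim_if_quaternionic[OF Aadd AscaleC, of "eigenspace R \<mu>" "r - r\<^sup>2"] AA eig by blast
  qed
  show ?thesis
    unfolding A R_def[symmetric]
  proof (intro conjI allI impI)
    fix v w and r :: real
    assume v: "v \<noteq> 0" "r > 0" "R v = r *\<^sub>R v" and w: "w = A v"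
    show "R w = r *\<^sub>R w" using RA[OF v(3)] w by simp
    show "w \<noteq> v" "complex_vector.independent {v, w}" if "r \<noteq> 1"
      using indep[OF v(3,1,2) that] w by simp_all
  qed (rule even)
qed

end
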